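(* Let $p,n\in\mathbb N$ with $p\ge n\ge 15$ and $p=k(n-1)+n-7$ for some $k\in\mathbb N$. Then $$\mathrm{ex}(p;T_n^3)=\frac{(n-2)p-6(n-7)}2+\max\Big\{\Big\lfloor\frac{n-37}4\Big\rfloor,0\Big\}.$$
   Context: All graphs are finite simple graphs. For a graph $L$, $\mathrm{ex}(p;L)$ denotes the maximum number of edges in a graph on $p$ vertices that contains no subgraph isomorphic to $L$. For $n\ge 6$, $T_n^3$ is the tree on vertex set $\{v_0,\ldots,v_{n-1}\}$ with edge set $\{v_0v_1,v_0v_2,\ldots,v_0v_{n-4},\ v_1v_{n-3},\ v_1v_{n-2},\ v_1v_{n-1}\}$. $\lfloor x\rfloor$ is the greatest integer not exceeding $x$; $\mathbb N=\{1,2,\ldots\}$. *)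

theory Defs
  imports Complex_Main
begin

definition simple_graph :: "'a set \<Rightarrow> 'a set set \<Rightarrow> bool" where
  "simple_graph V E \<longleftrightarrow> finite V \<and>
     (\<forall>e\<in>E. \<exists>x y. x \<in> V \<and> y \<in> V \<and> x \<noteq> y \<and> e = {x, y})"

definition contains_copy :: "'a set \<Rightarrow> 'a set set \<Rightarrow> 'b set \<Rightarrow> 'b set set \<Rightarrow> bool" where
  "contains_copy V E VL EL \<longleftrightarrow>
     (\<exists>f. inj_on f VL \<and> f ` VL \<subseteq> V \<and> (\<forall>e\<in>EL. f ` e \<in> E))"

definition ex :: "nat \<Rightarrow> 'b set \<Rightarrow> 'b set set \<Rightarrow> nat" where
  "ex p VL EL = Max {card E | E. simple_graph {0..<p} E \<and> \<not> contains_copy {0..<p} E VL EL}"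

definition T3_vertices :: "nat \<Rightarrow> nat set" where
  "T3_vertices n = {0..<n}"

definition T3_edges :: "nat \<Rightarrow> nat set set" where
  "T3_edges n = {{0, i} | i. 1 \<le> i \<and> i \<le> n - 4} \<union> {{1, n - 3}, {1, n - 2}, {1, n - 1}}"

end

(*
  Upper bound, by induction on k.  Write out(x, W) for the number of neighbours of x outside W.
  A set W of n - 1 vertices meets (sum over W of deg x + out(x, W)) / 2 edges; if this is at most
  the size of a clique on n - 1 vertices, delete W.  A vertex v of degree n - 4 + j forces every
  neighbour u of v to satisfy out(u, N[v]) + min(j, number of common neighbours) <= 2, and
  this produces such a W, essentially N[v] or N[v] plus one or two outside vertices, whenever
  some degree exceeds n - 4 or some vertex u of degree n - 4 has an adjacent vertex v of degree
  n - 4 with N[u] different from N[v].  If there is no such W, all degrees are at most n - 4, and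
  counting edges suffices for k >= 2.  For k = 1 there are 2n - 8 vertices, and the number of
  edges exceeds (n - 4)(n - 5) only through the vertices of degree n - 4.  These all lie in one
  N[v] (or are compensated by vertices of small degree), and counting the edges between
  N[v] and its complement shows that there are at most about (n - 1)/2 of them.

  Lower bound: disjoint cliques, or for n >= 37 the graph for which this last count is tight.
*)
theory Submission
  imports Defs
begin

section \<open>Copies of the tree as an edge with two disjoint sets of leaves\<close>

definition nbrs :: "'a set set \<Rightarrow> 'a \<Rightarrow> 'a set" where
  "nbrs E x = {y. {x, y} \<in> E}"

text \<open>
  The vertices \<open>v\<close> and \<open>u\<close> play the roles of \<open>v\<^sub>0\<close> and \<open>v\<^sub>1\<close>; \<open>S\<close> and \<open>L\<close> are their leaves.
\<close>

definition has_T3 :: "nat \<Rightarrow> 'a set set \<Rightarrow> bool" where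
  "has_T3 n E \<longleftrightarrow> (\<exists>v u S L. u \<in> nbrs E v \<and> S \<subseteq> nbrs E v - {u} \<and> L \<subseteq> nbrs E u - {v} \<and>
     S \<inter> L = {} \<and> card S = n - 5 \<and> card L = 3)"

lemma nbrs_commute: "y \<in> nbrs E x \<longleftrightarrow> x \<in> nbrs E y"
  by (simp add: nbrs_def insert_commute)

text \<open>The tree is two stars with adjacent centres. The indices \<open>2..n-4\<close> carry the
  leaves of one and \<open>n-3..n-1\<close> those of the other; leaves of one centre are
  interchangeable, so only the sets \<open>S\<close> and \<open>L\<close> matter.\<close>

lemma contains_T3_iff:
  assumes G: "simple_graph V E" and n: "6 \<le> n"
  shows "contains_copy V E (T3_vertices n) (T3_edges n) \<longleftrightarrow> has_T3 n E"
proof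
  assume "contains_copy V E (T3_vertices n) (T3_edges n)"
  then obtain f where f: "inj_on f {0..<n}" "\<forall>e\<in>T3_edges n. f ` e \<in> E"
    unfolding contains_copy_def T3_vertices_def by blast
  have e0: "f i \<in> nbrs E (f 0)" if "1 \<le> i" "i \<le> n - 4" for i
  proof -
    have "{0, i} \<in> T3_edges n" using that unfolding T3_edges_def by blast
    then show ?thesis using f(2) by (force simp: nbrs_def)
  qed
  have e1: "f i \<in> nbrs E (f 1)" if "n - 3 \<le> i" "i < n" for i
  proof -
    have "i = n - 3 \<or> i = n - 2 \<or> i = n - 1" using that n by linarith
    then have "{1, i} \<in> T3_edges n" unfolding T3_edges_def by blast
    then show ?thesis using f(2) by (force simp: nbrs_def)
  qed
  have neq: "f i \<noteq> f j" if "i < n" "j < n" "i \<noteq> j" for i j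
    using f(1) that by (auto simp: inj_on_def)
  have sub: "{2..n-4} \<subseteq> {0..<n}" "{n-3..n-1} \<subseteq> {0..<n}" using n by auto
  have "card (f ` {2..n-4}) = n - 5"
    using n card_image[OF inj_on_subset[OF f(1) sub(1)]] by simp
  moreover have "card (f ` {n-3..n-1}) = 3"
    using n card_image[OF inj_on_subset[OF f(1) sub(2)]] by simp
  moreover have "f 1 \<in> nbrs E (f 0)" using e0 n by simp
  moreover have "f ` {2..n-4} \<subseteq> nbrs E (f 0) - {f 1}"
  proof
    fix y assume "y \<in> f ` {2..n-4}"
    then obtain i where "y = f i" "2 \<le> i" "i \<le> n - 4" by auto
    then show "y \<in> nbrs E (f 0) - {f 1}" using e0[of i] neq[of i 1] n by auto
  qed
  moreover have "f ` {n-3..n-1} \<subseteq> nbrs E (f 1) - {f 0}"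
  proof
    fix y assume "y \<in> f ` {n-3..n-1}"
    then obtain i where "y = f i" "n - 3 \<le> i" "i \<le> n - 1" by auto
    then show "y \<in> nbrs E (f 1) - {f 0}" using e1[of i] neq[of i 0] n by auto
  qed
  moreover have "f ` {2..n-4} \<inter> f ` {n-3..n-1} = {}"
  proof -
    have "f i \<noteq> f j" if "i \<in> {2..n-4}" "j \<in> {n-3..n-1}" for i j
      using that n by (intro neq) auto
    then show ?thesis by blast
  qed
  ultimately show "has_T3 n E" unfolding has_T3_def by blast
next
  assume "has_T3 n E"
  then obtain v u S L where T: "u \<in> nbrs E v" "S \<subseteq> nbrs E v - {u}" "L \<subseteq> nbrs E u - {v}"
    "S \<inter> L = {}" "card S = n - 5" "card L = 3"
    unfolding has_T3_def by blast
  have inV: "y \<in> V \<and> x \<in> V \<and> x \<noteq> y" if "y \<in> nbrs E x" for x y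
    using G that unfolding simple_graph_def nbrs_def by (force simp: doubleton_eq_iff)
  have vS: "v \<notin> S" "u \<notin> L" "v \<noteq> u" using T inV by blast+
  have fin: "finite V" using G by (simp add: simple_graph_def)
  have "S \<subseteq> V" "L \<subseteq> V" using T(2,3) inV by blast+
  then have "finite S" "finite L" using fin finite_subset by blast+
  then obtain g h where g: "bij_betw g {2..n-4} S" and h: "bij_betw h {n-3..n-1} L"
    using finite_same_card_bij[of "{2..n-4}" S] finite_same_card_bij[of "{n-3..n-1}" L] T n by auto
  define f where "f i = (if i = 0 then v else if i = 1 then u else if i \<le> n - 4 then g i else h i)" for i
  have f0: "f 0 = v" "f (Suc 0) = u" by (auto simp: f_def)
  have fg: "f i = g i" "g i \<in> S" if "2 \<le> i" "i \<le> n - 4" for i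
    using that bij_betwE[OF g] by (auto simp: f_def)
  have fh: "f i = h i" "h i \<in> L" if "n - 3 \<le> i" "i < n" for i
    using that bij_betwE[OF h] n by (auto simp: f_def)
  have cases: "i = 0 \<or> i = 1 \<or> (2 \<le> i \<and> i \<le> n - 4) \<or> (n - 3 \<le> i \<and> i < n)" if "i < n" for i
    using that by linarith
  have "inj_on f {0..<n}"
  proof (rule inj_onI)
    fix i j assume ij: "i \<in> {0..<n}" "j \<in> {0..<n}" "f i = f j"
    then have lt: "i < n" "j < n" by auto
    have apart: "v \<notin> S" "u \<notin> S" "v \<notin> L" "u \<notin> L" "v \<noteq> u" "S \<inter> L = {}"
      using vS T(2,3,4) by auto
    have gi: "a = b" if "2 \<le> a" "a \<le> n - 4" "2 \<le> b" "b \<le> n - 4" "f a = f b" for a b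
      using that fg[of a] fg[of b] g unfolding bij_betw_def inj_on_def by auto
    have hi: "a = b" if "n - 3 \<le> a" "a < n" "n - 3 \<le> b" "b < n" "f a = f b" for a b
      using that fh[of a] fh[of b] h unfolding bij_betw_def inj_on_def by auto
    have gS: "f a \<in> S" if "2 \<le> a" "a \<le> n - 4" for a using that fg[of a] by simp
    have hL: "f a \<in> L" if "n - 3 \<le> a" "a < n" for a using that fh[of a] by simp
    have f01: "f 0 = v" "f 1 = u" using f0 by auto
    show "i = j"
    proof (cases "i = 0 \<or> i = 1"; cases "j = 0 \<or> j = 1")
      assume "i = 0 \<or> i = 1" "j = 0 \<or> j = 1"
      then show ?thesis using ij(3) f01 apart by auto
    next
      assume "i = 0 \<or> i = 1" "\<not> (j = 0 \<or> j = 1)"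
      then have "f j \<in> S \<union> L" "f i \<in> {v, u}" using cases[OF lt(2)] gS[of j] hL[of j] f01 by auto
      then show ?thesis using ij(3) apart by auto
    next
      assume "\<not> (i = 0 \<or> i = 1)" "j = 0 \<or> j = 1"
      then have "f i \<in> S \<union> L" "f j \<in> {v, u}" using cases[OF lt(1)] gS[of i] hL[of i] f01 by auto
      then show ?thesis using ij(3) apart by auto
    next
      assume "\<not> (i = 0 \<or> i = 1)" "\<not> (j = 0 \<or> j = 1)"
      then show ?thesis using cases[OF lt(1)] cases[OF lt(2)] gi[of i j] hi[of i j] ij(3)
          gS[of i] gS[of j] hL[of i] hL[of j] apart by auto
    qed
  qed
  moreover have fe: "f i \<in> nbrs E v" if "1 \<le> i" "i \<le> n - 4" for i
    using that fg[of i] f0 T(1,2) by (cases "i = 1") auto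
  have fe': "f i \<in> nbrs E u" if "n - 3 \<le> i" "i < n" for i
    using that fh[of i] T(3) by auto
  have "f ` {0..<n} \<subseteq> V"
  proof
    fix y assume "y \<in> f ` {0..<n}"
    then obtain i where i: "y = f i" "i < n" by auto
    from cases[OF i(2)] show "y \<in> V"
      using f0 fe[of i] fe'[of i] i T(1) inV by (elim disjE) auto
  qed
  moreover have "\<forall>e\<in>T3_edges n. f ` e \<in> E"
    using fe fe' f0 n unfolding T3_edges_def by (auto simp: nbrs_def)
  ultimately show "contains_copy V E (T3_vertices n) (T3_edges n)"
    unfolding contains_copy_def T3_vertices_def by blast
qed

section \<open>Counting edges in finite simple graphs\<close>

locale ugraph =
  fixes V :: "'a set" and E :: "'a set set"
  assumes simple: "simple_graph V E"
begin

abbreviation N :: "'a \<Rightarrow> 'a set" where "N \<equiv> nbrs E"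
abbreviation deg :: "'a \<Rightarrow> nat" where "deg x \<equiv> card (nbrs E x)"

lemma finite_V [simp]: "finite V"
  using simple by (simp add: simple_graph_def)

lemma N_D: "y \<in> N x \<Longrightarrow> x \<in> V \<and> y \<in> V \<and> x \<noteq> y"
  using simple unfolding simple_graph_def nbrs_def by (force simp: doubleton_eq_iff)

lemma N_subset: "N x \<subseteq> V" using N_D by blast

lemma self_notin_N [simp]: "x \<notin> N x" using N_D by blast

lemma finite_N [simp]: "finite (N x)" using N_subset finite_V finite_subset by blast

lemma E_subset: "E \<subseteq> Pow V"
  using simple unfolding simple_graph_def by fastforce

lemma finite_E: "finite E" using E_subset by (rule finite_subset) simp

lemma handshake: "(\<Sum>x\<in>V. deg x) = 2 * card E"
proof -
  have "deg x = card {e \<in> E. x \<in> e}" if "x \<in> V" for x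
  proof -
    have "{e \<in> E. x \<in> e} = (\<lambda>y. {x, y}) ` N x"
    proof
      show "{e \<in> E. x \<in> e} \<subseteq> (\<lambda>y. {x, y}) ` N x"
      proof
        fix e assume e: "e \<in> {e \<in> E. x \<in> e}"
        then obtain a b where "e = {a, b}" using simple unfolding simple_graph_def by blast
        then consider "e = {x, b}" | "e = {x, a}" using e by blast
        then show "e \<in> (\<lambda>y. {x, y}) ` N x" using e by cases (auto simp: nbrs_def)
      qed
    qed (auto simp: nbrs_def)
    moreover have "inj_on (\<lambda>y. {x, y}) (N x)" by (auto simp: inj_on_def doubleton_eq_iff)
    ultimately show ?thesis by (simp add: card_image)
  qed
  moreover have "(\<Sum>x\<in>V. card {e \<in> E. x \<in> e}) = 2 * card E"
  proof (rule sum_multicount)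
    show "\<forall>e\<in>E. card {x \<in> V. x \<in> e} = 2"
    proof
      fix e assume "e \<in> E"
      then obtain a b where "a \<in> V" "b \<in> V" "a \<noteq> b" "e = {a, b}"
        using simple unfolding simple_graph_def by blast
      then have "{x \<in> V. x \<in> e} = {a, b}" by auto
      then show "card {x \<in> V. x \<in> e} = 2" using \<open>a \<noteq> b\<close> by simp
    qed
  qed (use finite_E in auto)
  ultimately show ?thesis by simp
qed

lemma sum_cross:
  assumes "finite A" "finite B"
  shows "(\<Sum>x\<in>A. card (N x \<inter> B)) = (\<Sum>y\<in>B. card (N y \<inter> A))"
proof -
  have c: "card (N x \<inter> S) = (\<Sum>y\<in>S. of_bool (y \<in> N x))" if "finite S" for x and S :: "'a set"
    using that by (simp add: sum.If_cases of_bool_def Int_commute Int_def)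
  have "(\<Sum>x\<in>A. card (N x \<inter> B)) = (\<Sum>x\<in>A. \<Sum>y\<in>B. of_bool (y \<in> N x))"
    using assms by (simp add: c)
  also have "\<dots> = (\<Sum>y\<in>B. \<Sum>x\<in>A. of_bool (x \<in> N y))"
    by (subst sum.swap) (simp add: nbrs_commute)
  also have "\<dots> = (\<Sum>y\<in>B. card (N y \<inter> A))"
    using assms by (simp add: c)
  finally show ?thesis .
qed

lemma card_N_split: "finite S \<Longrightarrow> card (N x \<inter> S) + card (N x - S) = deg x"
  by (subst card_Un_disjoint[symmetric]) (auto intro: arg_cong[where f = card])

text \<open>An edge inside \<open>W\<close> is counted by the degrees of both ends, an edge leaving
  \<open>W\<close> once as a degree and once as an outside neighbour. So every edge that meets
  \<open>W\<close> counts twice.\<close>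

lemma delete_vertices:
  assumes W: "W \<subseteq> V"
  defines "E' \<equiv> {e \<in> E. e \<subseteq> V - W}"
  shows "simple_graph (V - W) E'"
    and "2 * card E = (\<Sum>x\<in>W. deg x + card (N x - W)) + 2 * card E'"
proof -
  show G': "simple_graph (V - W) E'"
    unfolding simple_graph_def
  proof (intro conjI ballI)
    fix e assume e: "e \<in> E'"
    then have "e \<in> E" unfolding E'_def by simp
    then obtain x y where "x \<noteq> y" "e = {x, y}"
      using simple unfolding simple_graph_def by meson
    then show "\<exists>x y. x \<in> V - W \<and> y \<in> V - W \<and> x \<noteq> y \<and> e = {x, y}"
      using e unfolding E'_def by blast
  qed simp
  interpret G': ugraph "V - W" E' by unfold_locales (rule G')
  have fW: "finite W" using W finite_V by (rule finite_subset)
  have N': "nbrs E' x = N x - W" if "x \<in> V - W" for x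
    using that N_subset[of x] unfolding nbrs_def E'_def by auto
  have "2 * card E = (\<Sum>x\<in>W. deg x) + (\<Sum>x\<in>V-W. deg x)"
    using handshake sum.subset_diff[OF W finite_V] by (metis add.commute)
  also have "(\<Sum>x\<in>V-W. deg x) = (\<Sum>x\<in>V-W. card (N x \<inter> W)) + (\<Sum>x\<in>V-W. card (N x - W))"
    by (simp add: card_N_split fW flip: sum.distrib)
  also have "(\<Sum>x\<in>V-W. card (N x \<inter> W)) = (\<Sum>x\<in>W. card (N x \<inter> (V - W)))"
    using fW by (simp add: sum_cross)
  also have "\<dots> = (\<Sum>x\<in>W. card (N x - W))"
    using N_subset by (intro sum.cong arg_cong[where f = card]) blast+
  also have "(\<Sum>x\<in>V-W. card (N x - W)) = 2 * card E'"
    using G'.handshake N' by simp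
  finally show "2 * card E = (\<Sum>x\<in>W. deg x + card (N x - W)) + 2 * card E'"
    by (simp add: sum.distrib)
qed

end

section \<open>Large degrees and the vertex sets they allow to delete\<close>

locale T3_free = ugraph V E for V :: "'a set" and E +
  fixes n :: nat
  assumes n15: "15 \<le> n" and free: "\<not> has_T3 n E"
begin

abbreviation clN :: "'a \<Rightarrow> 'a set" where "clN x \<equiv> insert x (nbrs E x)"

text \<open>Otherwise three leaves for \<open>u\<close> can be taken from \<open>N u - clN v\<close>
  and \<open>C\<close>. This costs \<open>v\<close> at most \<open>card C\<close> neighbours, and by
  the size of \<open>C\<close> there remain \<open>n - 5\<close> leaves for \<open>v\<close> besides
  \<open>u\<close>.\<close>

lemma outside_common_bound:
  assumes u: "u \<in> N v" and dv: "n - 4 \<le> deg v"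
    and C: "C \<subseteq> N u \<inter> N v" "card C \<le> deg v - (n - 4)"
  shows "card (N u - clN v) + card C \<le> 2"
proof (rule ccontr)
  assume "\<not> ?thesis"
  moreover have fC: "finite C" by (rule finite_subset[OF C(1)]) simp
  moreover have "card ((N u - clN v) \<union> C) = card (N u - clN v) + card C"
    using C fC by (intro card_Un_disjoint) auto
  ultimately have "3 \<le> card ((N u - clN v) \<union> C)" by simp
  then obtain L where L: "L \<subseteq> (N u - clN v) \<union> C" "card L = 3" "finite L"
    by (rule obtain_subset_with_card_n)
  have "N v - {u} - C \<subseteq> N v - {u} - L" using L by blast
  moreover have "card (N v - {u} - C) = deg v - 1 - card C"
    using C fC u self_notin_N[of u] by (subst card_Diff_subset) (auto simp: card_Diff_singleton)
  ultimately have "n - 5 \<le> card (N v - {u} - L)"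
    using C(2) dv n15 card_mono[of "N v - {u} - L" "N v - {u} - C"] by simp
  then obtain S where S: "S \<subseteq> N v - {u} - L" "card S = n - 5"
    by (rule obtain_subset_with_card_n)
  have "L \<subseteq> N u - {v}" using L(1) C(1) self_notin_N[of v] by blast
  then have "has_T3 n E" unfolding has_T3_def using u S L(2)
    by (intro exI[of _ v] exI[of _ u] exI[of _ S] exI[of _ L]) auto
  then show False using free by simp
qed

lemma deg_split: "u \<in> N v \<Longrightarrow> deg u = 1 + card (N u \<inter> N v) + card (N u - clN v)"
proof -
  assume u: "u \<in> N v"
  have "v \<in> N u" using u nbrs_commute[of u E v] by simp
  then have "N u \<inter> clN v = insert v (N u \<inter> N v)" by blast
  then have "card (N u \<inter> clN v) = 1 + card (N u \<inter> N v)" by simp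
  then show ?thesis using card_N_split[of "clN v" u] by simp
qed

lemma outside_le_2: "u \<in> N v \<Longrightarrow> n - 4 \<le> deg v \<Longrightarrow> card (N u - clN v) \<le> 2"
  using outside_common_bound[of u v "{}"] by simp

text \<open>Here \<open>j\<close> is a surplus of \<open>deg v\<close> over \<open>n - 4\<close>. If
  the common neighbours attain the minimum, \<open>deg_split\<close> leaves \<open>u\<close> with
  degree at most 3; otherwise \<open>u\<close> has at most \<open>2 - j\<close> neighbours outside
  \<open>clN v\<close>.\<close>

lemma common_bound:
  assumes u: "u \<in> N v" and dv: "n - 4 + j \<le> deg v"
  shows "card (N u - clN v) + min j (card (N u \<inter> N v)) \<le> 2"
proof -
  have "min j (card (N u \<inter> N v)) \<le> card (N u \<inter> N v)" by simp
  then obtain C where C: "C \<subseteq> N u \<inter> N v" "card C = min j (card (N u \<inter> N v))"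
    by (rule obtain_subset_with_card_n)
  then show ?thesis using outside_common_bound[OF u _ C(1)] dv by simp
qed

definition reducible :: bool where
  "reducible \<longleftrightarrow> (\<exists>W\<subseteq>V. card W = n - 1 \<and> (\<Sum>x\<in>W. deg x + card (N x - W)) \<le> (n - 1) * (n - 2))"

lemma reducibleI:
  assumes "W \<subseteq> V" "card W = n - 1" "\<And>x. x \<in> W \<Longrightarrow> deg x + card (N x - W) \<le> n - 2"
  shows reducible
  unfolding reducible_def using assms sum_bounded_above[of W "\<lambda>x. deg x + card (N x - W)" "n - 2"]
  by auto

lemma out_le_deg: "card (N x - W) \<le> deg x"
  by (simp add: card_mono)

lemma clN_subset: "v \<in> V \<Longrightarrow> clN v \<subseteq> V" using N_subset by blast

text \<open>With surplus 3 every neighbour of \<open>v\<close> has degree at most 3, so any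
  \<open>n - 1\<close> of them meet few edges.\<close>

lemma reducible_deg_ge:
  assumes dv: "n - 1 \<le> deg v"
  shows reducible
proof -
  obtain W where W: "W \<subseteq> N v" "card W = n - 1" by (rule obtain_subset_with_card_n[OF dv])
  show ?thesis
  proof (rule reducibleI)
    show "W \<subseteq> V" using W N_subset by blast
    fix u assume "u \<in> W"
    then have u: "u \<in> N v" using W by blast
    have "deg u \<le> 3" using common_bound[OF u, of 3] deg_split[OF u] dv n15 by simp
    then show "deg u + card (N u - W) \<le> n - 2" using out_le_deg[of u W] n15 by simp
  qed (rule W)
qed

text \<open>\<open>clN v\<close> already has \<open>n - 1\<close> vertices. With surplus 2, a
  neighbour of \<open>v\<close> either has no neighbour outside or has degree at most 3.\<close>

lemma reducible_deg_eq_2: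
  assumes v: "v \<in> V" and dv: "deg v = n - 2" and D: "\<And>x. deg x \<le> n - 2"
  shows reducible
proof (rule reducibleI)
  fix u assume "u \<in> clN v"
  then show "deg u + card (N u - clN v) \<le> n - 2"
  proof
    assume "u = v"
    moreover have "N v - clN v = {}" by blast
    ultimately show ?thesis using dv by simp
  next
    assume u: "u \<in> N v"
    show ?thesis using common_bound[OF u, of 2] deg_split[OF u] dv n15 D[of u] by linarith
  qed
qed (use clN_subset[OF v] dv n15 in auto)

text \<open>\<open>clN v\<close> is one vertex short. If a neighbour \<open>u\<close> of degree
  \<open>n - 3\<close> has an outside neighbour \<open>w\<close>, then \<open>w\<close> is added, as
  it has hardly any neighbours outside \<open>clN u\<close>. Otherwise each vertex of
  \<open>clN v\<close> stays one below the allowance \<open>n - 2\<close>, which pays for an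
  arbitrary outside vertex.\<close>

lemma reducible_deg_eq_3:
  assumes v: "v \<in> V" and dv: "deg v = n - 3" and D: "\<And>x. deg x \<le> n - 3" and p: "n - 1 \<le> card V"
  shows reducible
proof -
  let ?A = "clN v"
  have cA: "card ?A = n - 2" using dv n15 by simp
  have b: "card (N u - clN x) \<le> 1 \<or> card (N u - clN x) \<le> 2 \<and> deg u \<le> 3"
    if "u \<in> N x" "deg x = n - 3" for u x
    using common_bound[OF that(1), of 1] deg_split[OF that(1)] that(2) n15 by linarith
  have bA: "deg x + card (N x - ?A) \<le> n - 2" if "x \<in> ?A" for x
  proof (cases "x = v")
    case True
    moreover have "N v - ?A = {}" by blast
    ultimately show ?thesis using dv by simp
  next
    case False
    then show ?thesis using b[of x v] that dv D[of x] n15 by auto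
  qed
  have WA: "deg x + card (N x - insert w ?A) \<le> deg x + card (N x - ?A)" for x w
    by (auto intro: card_mono)
  \<comment> \<open>Substituting \<open>n = m + 15\<close> removes truncated subtraction from the
    polynomial inequality below.\<close>
  define m where "m = n - 15"
  then have m: "n = m + 15" using n15 by simp
  show ?thesis
  proof (cases "\<exists>u\<in>N v. deg u = n - 3 \<and> card (N u - ?A) = 1")
    case True
    then obtain u w where u: "u \<in> N v" "deg u = n - 3" "N u - ?A = {w}"
      by (auto simp: card_1_singleton_iff)
    then have w: "w \<in> N u" "w \<notin> ?A" by blast+
    show ?thesis
    proof (rule reducibleI)
      show "insert w ?A \<subseteq> V" using clN_subset[OF v] N_D[OF w(1)] by blast
      show "card (insert w ?A) = n - 1" using w cA n15 by (simp del: insert_iff)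
      fix x assume "x \<in> insert w ?A"
      then consider "x = w" | "x \<in> ?A" by blast
      then show "deg x + card (N x - insert w ?A) \<le> n - 2"
      proof cases
        case 1
        have "N w - insert w ?A \<subseteq> N w - clN u" using u by blast
        then have "card (N w - insert w ?A) \<le> card (N w - clN u)" by (intro card_mono) auto
        then show ?thesis using b[OF w(1) u(2)] D[of w] 1 n15 by auto
      next
        case 2
        then show ?thesis using bA[of x] WA[of x w] by linarith
      qed
    qed
  next
    case False
    have bA': "deg x + card (N x - ?A) \<le> n - 3" if "x \<in> ?A" for x
    proof (cases "x = v")
      case True
      moreover have "N v - ?A = {}" by blast
      ultimately show ?thesis using dv by simp
    next
      case F: False
      then have x: "x \<in> N v" using that by blast
      have "\<not> (deg x = n - 3 \<and> card (N x - ?A) = 1)" using False x by blast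
      then show ?thesis using b[OF x dv] D[of x] n15 by linarith
    qed
    have "card ?A < card V" using cA p n15 by simp
    then have "\<not> V \<subseteq> ?A" using card_mono[of ?A V] by (auto simp del: card_insert_disjoint)
    then obtain w where w: "w \<in> V" "w \<notin> ?A" by blast
    let ?W = "insert w ?A"
    have "(\<Sum>x\<in>?W. deg x + card (N x - ?W)) = deg w + card (N w - ?W) + (\<Sum>x\<in>?A. deg x + card (N x - ?W))"
      using w by (subst sum.insert) auto
    also have "(\<Sum>x\<in>?A. deg x + card (N x - ?W)) \<le> of_nat (card ?A) * (n - 3)"
      using bA' WA by (intro sum_bounded_above) (meson le_trans)
    also have "deg w + card (N w - ?W) \<le> 2 * (n - 3)"
      using D[of w] out_le_deg[of w ?W] by linarith
    finally have "(\<Sum>x\<in>?W. deg x + card (N x - ?W)) \<le> 2 * (n - 3) + (n - 2) * (n - 3)"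
      using cA by simp
    also have "2 * (n - 3) + (n - 2) * (n - 3) \<le> (n - 1) * (n - 2)"
      unfolding m by (simp add: algebra_simps)
    finally have "(\<Sum>x\<in>?W. deg x + card (N x - ?W)) \<le> (n - 1) * (n - 2)" .
    moreover have "?W \<subseteq> V" using clN_subset[OF v] w by blast
    moreover have "card ?W = n - 1" using w cA n15 by (simp del: insert_iff)
    ultimately show ?thesis unfolding reducible_def by blast
  qed
qed

end

context T3_free
begin

text \<open>Once \<open>irreducible_structure\<close> applies, these are the vertices of the largest
  degree still possible, the only ones above \<open>n - 5\<close>.\<close>

definition hubs :: "'a set" where "hubs = {x \<in> V. deg x = n - 4}"

text \<open>\<open>clN v\<close> is two vertices short. Two vertices of \<open>W0\<close> together
  exceed the allowance \<open>n - 2\<close> per vertex by at most 2, which \<open>v\<close> itself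
  saves. If \<open>w\<close> is alone in \<open>W0\<close>, each neighbour of \<open>v\<close> saves
  one, which pays for an arbitrary second vertex.\<close>

lemma reducible_deg_eq_4:
  assumes v: "v \<in> V" and dv: "deg v = n - 4" and D: "\<And>x. deg x \<le> n - 4" and p: "n - 1 \<le> card V"
    and u: "u \<in> N v" "deg u = n - 4" and w: "w \<in> N u" "w \<notin> clN v"
  shows reducible
proof -
  let ?A = "clN v"
  have cA: "card ?A = n - 3" using dv n15 by simp
  \<comment> \<open>Vertices of \<open>W0\<close> have almost all their neighbours in \<open>N[v]\<close>, so they are cheap to add to it.\<close>
  define W0 where "W0 = (\<Union>u\<in>{u \<in> N v. deg u = n - 4}. N u - ?A)"
  have outv: "N v - ?A = {}" by blast
  have dW0: "card (N w - insert w ?A) \<le> 3" if wW: "w \<in> W0" for w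
  proof -
    obtain u where u: "u \<in> N v" "deg u = n - 4" "w \<in> N u - ?A" using wW unfolding W0_def by blast
    \<comment> \<open>At most two neighbours of \<open>w\<close> lie outside \<open>clN u\<close>;
      within \<open>clN u\<close> only vertices of \<open>N u - ?A\<close> other than
      \<open>w\<close> count, at most one.\<close>
    have "N w - insert w ?A \<subseteq> (N w - clN u) \<union> (N u - ?A - {w})" using u(1) by blast
    then have "card (N w - insert w ?A) \<le> card ((N w - clN u) \<union> (N u - ?A - {w}))"
      by (intro card_mono) auto
    also have "\<dots> \<le> card (N w - clN u) + card (N u - ?A - {w})" by (rule card_Un_le)
    also have "card (N w - clN u) \<le> 2" using outside_le_2 u by simp
    also have "card (N u - ?A - {w}) = card (N u - ?A) - 1" using u(3) by (rule card_Diff_singleton)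
    also have "\<dots> \<le> 1" using outside_le_2[OF u(1)] dv by simp
    finally show ?thesis by simp
  qed
  have w1: "w \<in> W0" using u w unfolding W0_def by blast
  have W0V: "W0 \<subseteq> V" unfolding W0_def using N_subset by blast
  have W0A: "W0 \<inter> ?A = {}" unfolding W0_def by blast
  have sum4: "(\<Sum>x\<in>?A \<union> {a, b}. deg x + card (N x - (?A \<union> {a, b}))) \<le>
      (n - 4) + (n - 4) * c + (deg a + card (N a - insert a ?A)) + (deg b + card (N b - insert b ?A))"
    if ab: "a \<notin> ?A" "b \<notin> ?A" "a \<noteq> b" and c: "\<And>x. x \<in> N v \<Longrightarrow> deg x + card (N x - ?A) \<le> c" for a b c
  proof -
    let ?W = "?A \<union> {a, b}"
    let ?f = "\<lambda>x. deg x + card (N x - ?W)"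
    have "?W = insert a (insert b (insert v (N v)))" by blast
    then have "sum ?f ?W = ?f a + (?f b + (?f v + sum ?f (N v)))"
      using ab by (simp add: insert_commute)
    moreover have "sum ?f (N v) \<le> of_nat (card (N v)) * c"
    proof (rule sum_bounded_above)
      fix x assume "x \<in> N v"
      moreover have "card (N x - ?W) \<le> card (N x - ?A)" by (auto intro: card_mono)
      ultimately show "?f x \<le> c" using c[of x] by linarith
    qed
    moreover have "?f v = n - 4"
    proof -
      have "N v - ?W = {}" by blast
      then show ?thesis using dv by simp
    qed
    moreover have "card (N a - ?W) \<le> card (N a - insert a ?A)" "card (N b - ?W) \<le> card (N b - insert b ?A)"
      by (rule card_mono, simp, blast)+
    ultimately show ?thesis by (simp only: of_nat_id dv)
  qed
  have WV: "?A \<union> {a, b} \<subseteq> V" "card (?A \<union> {a, b}) = n - 1"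
    if "a \<notin> ?A" "b \<notin> ?A" "a \<noteq> b" "a \<in> V" "b \<in> V" for a b
  proof -
    show "?A \<union> {a, b} \<subseteq> V" using clN_subset[OF v] that by blast
    have "card (?A \<union> {a, b}) = card ?A + card {a, b}"
      using that by (intro card_Un_disjoint) auto
    then show "card (?A \<union> {a, b}) = n - 1" using that cA n15 by simp
  qed
  define m where "m = n - 15"
  then have m: "n = m + 15" using n15 by simp
  show ?thesis
  proof (cases "\<exists>w'\<in>W0. w' \<noteq> w")
    case True
    then obtain w' where w': "w' \<in> W0" "w' \<noteq> w" by blast
    have ww: "w \<notin> ?A" "w' \<notin> ?A" "w \<noteq> w'" "w \<in> V" "w' \<in> V" using w1 w' W0A W0V by blast+
    have "deg x + card (N x - ?A) \<le> n - 2" if "x \<in> N v" for x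
      using outside_le_2[OF that] D[of x] dv n15 by simp
    from sum4[OF ww(1-3) this]
    have "(\<Sum>x\<in>?A \<union> {w, w'}. deg x + card (N x - (?A \<union> {w, w'}))) \<le>
      (n - 4) + (n - 4) * (n - 2) + (n - 4 + 3) + (n - 4 + 3)"
      using dW0[OF w1] dW0[OF w'(1)] D[of w] D[of w'] by linarith
    also have "\<dots> \<le> (n - 1) * (n - 2)" unfolding m by (simp add: algebra_simps)
    finally show ?thesis using WV[OF ww] unfolding reducible_def by blast
  next
    case False
    then have W0: "W0 = {w}" using w1 by blast
    have wA: "w \<notin> ?A" "w \<in> V" using w1 W0A W0V by blast+
    then have "card (insert w ?A) < card V" using cA p n15 by simp
    then have "\<not> V \<subseteq> insert w ?A" using card_mono[of "insert w ?A" V] by fastforce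
    then obtain w' where w': "w' \<in> V" "w' \<notin> ?A" "w' \<noteq> w" by blast
    have ww: "w \<notin> ?A" "w' \<notin> ?A" "w \<noteq> w'" using wA w' by blast+
    have "deg x + card (N x - ?A) \<le> n - 3" if x: "x \<in> N v" for x
    proof (cases "deg x = n - 4")
      case True
      then have "N x - ?A \<subseteq> {w}" using W0 x unfolding W0_def by blast
      then have "card (N x - ?A) \<le> card {w}" by (intro card_mono) auto
      then show ?thesis using True n15 by simp
    next
      case False
      then show ?thesis using outside_le_2[OF x] D[of x] dv n15 by simp
    qed
    from sum4[OF ww this]
    have "(\<Sum>x\<in>?A \<union> {w, w'}. deg x + card (N x - (?A \<union> {w, w'}))) \<le>
      (n - 4) + (n - 4) * (n - 3) + (n - 4 + 3) + (n - 4 + (n - 4))"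
      using dW0[OF w1] D[of w] D[of w'] out_le_deg[of w' "insert w' ?A"] by linarith
    also have "\<dots> \<le> (n - 1) * (n - 2)" unfolding m by (simp add: algebra_simps)
    finally show ?thesis using WV[OF ww wA(2) w'(1)] unfolding reducible_def by blast
  qed
qed

text \<open>Each reduction assumes that larger degrees are excluded, so the values are excluded
  downwards from \<open>n - 1\<close>. For adjacent hubs an inclusion suffices, as both closed
  neighbourhoods have \<open>n - 3\<close> elements.\<close>

lemma irreducible_structure:
  assumes irr: "\<not> reducible" and p: "n - 1 \<le> card V"
  shows "deg x \<le> n - 4"
    and "\<lbrakk>v \<in> hubs; u \<in> hubs; u \<in> N v\<rbrakk> \<Longrightarrow> clN u = clN v"
proof -
  have out: "deg x = 0" if "x \<notin> V" for x
  proof -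
    have "N x = {}" using N_D[of _ x] that by blast
    then show ?thesis by simp
  qed
  have 1: "deg x \<le> n - 2" for x using reducible_deg_ge[of x] irr by linarith
  have n2: "deg x \<noteq> n - 2" for x using reducible_deg_eq_2[of x] 1 out[of x] irr n15 by fastforce
  have 2: "deg x \<le> n - 3" for x using 1[of x] n2[of x] n15 by linarith
  have n3: "deg x \<noteq> n - 3" for x using reducible_deg_eq_3[of x] 2 out[of x] irr p n15 by fastforce
  have 3: "deg x \<le> n - 4" for x using 2[of x] n3[of x] n15 by linarith
  show "deg x \<le> n - 4" by (rule 3)
  show "clN u = clN v" if "v \<in> hubs" "u \<in> hubs" "u \<in> N v"
  proof (rule card_subset_eq)
    show "clN u \<subseteq> clN v"
      using reducible_deg_eq_4[of v u] that 3 p irr unfolding hubs_def by blast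
  qed (use that in \<open>auto simp: hubs_def\<close>)
qed

end

section \<open>The case \<open>k = 1\<close> when nothing can be deleted: counting hubs\<close>

locale irreducible_T3_free = T3_free +
  assumes card_V: "card V = 2 * n - 8" and irr: "\<not> reducible"
begin

lemma deg_le: "deg x \<le> n - 4"
  using irreducible_structure(1) irr card_V n15 by simp

lemma clN_eq: "\<lbrakk>v \<in> hubs; u \<in> hubs; u \<in> N v\<rbrakk> \<Longrightarrow> clN u = clN v"
  using irreducible_structure(2) irr card_V n15 by simp

text \<open>
  Since \<open>deg y \<le> n - 5\<close> off the hubs, the truncated subtraction is exact.
\<close>

definition defect :: nat where "defect = (\<Sum>y\<in>V - hubs. n - 5 - deg y)"

lemma hubs_subset: "hubs \<subseteq> V" by (auto simp: hubs_def)

lemma finite_hubs [simp]: "finite hubs" using hubs_subset finite_V by (rule finite_subset)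

lemma defect_ge: "S \<subseteq> V - hubs \<Longrightarrow> (\<Sum>y\<in>S. n - 5 - deg y) \<le> defect"
  unfolding defect_def by (intro sum_mono2) auto

text \<open>Degrees are compared with \<open>n - 5\<close>: each hub exceeds it by one, and the
  others fall short by \<open>defect\<close> in total. It remains to bound \<open>card hubs\<close>
  in terms of \<open>defect\<close>.\<close>

lemma size_eq: "2 * card E + defect = (2 * n - 8) * (n - 5) + card hubs"
proof -
  have "deg y + (n - 5 - deg y) = n - 5" if "y \<in> V - hubs" for y
  proof -
    have "deg y \<noteq> n - 4" using that by (auto simp: hubs_def)
    then show ?thesis using deg_le[of y] n15 by linarith
  qed
  then have "(\<Sum>y\<in>V-hubs. deg y) + defect = card (V - hubs) * (n - 5)"
    unfolding defect_def by (simp flip: sum.distrib)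
  moreover have "(\<Sum>y\<in>hubs. deg y) = card hubs * (n - 4)"
    by (simp add: hubs_def)
  moreover have "2 * card E = (\<Sum>y\<in>V-hubs. deg y) + (\<Sum>y\<in>hubs. deg y)"
    using handshake sum.subset_diff[OF hubs_subset finite_V, of "\<lambda>y. deg y"] by simp
  moreover have "card (V - hubs) + card hubs = 2 * n - 8"
    using card_V hubs_subset card_mono[OF finite_V hubs_subset] by (simp add: card_Diff_subset)
  moreover have "n - 4 = n - 5 + 1" using n15 by simp
  moreover have "(2 * n - 8) * (n - 5) = card (V - hubs) * (n - 5) + card hubs * (n - 5)"
    using calculation(4) by (metis add_mult_distrib)
  ultimately show ?thesis by (simp add: algebra_simps)
qed

lemma hub_clN_eq:
  assumes v: "v \<in> hubs" and z: "z \<in> hubs" "z \<in> clN v"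
  shows "clN z = clN v"
  using clN_eq[OF v z(1)] z(2) by (cases "z = v") auto

text \<open>The edges between \<open>clN v\<close> and the other \<open>n - 5\<close> vertices are
  counted from both sides. Each of those vertices has a neighbour in \<open>clN v\<close> or adds to
  \<open>defect\<close>; in \<open>clN v\<close>, hubs have no outside neighbour and other vertices
  at most two.\<close>

lemma hubs_in_clN:
  assumes v: "v \<in> hubs" and sub: "hubs \<subseteq> clN v"
  shows "2 * card hubs \<le> n - 1 + defect"
proof -
  let ?A = "clN v" let ?B = "V - clN v"
  have vV: "v \<in> V" and dv: "deg v = n - 4" using v by (auto simp: hubs_def)
  have cA: "card ?A = n - 3" using dv n15 by simp
  have cB: "card ?B = n - 5"
    using card_V cA n15 clN_subset[OF vV] by (subst card_Diff_subset) auto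
  have fB: "finite ?B" by simp
  have "1 \<le> card (N y \<inter> ?A) + (n - 5 - deg y)" if y: "y \<in> ?B" for y
  proof -
    have "N y \<subseteq> V" using N_subset .
    then have "N y - ?A \<subseteq> ?B - {y}" using self_notin_N[of y] by blast
    then have "card (N y - ?A) \<le> card (?B - {y})" by (intro card_mono) auto
    also have "\<dots> = n - 6" using y cB by simp
    finally show ?thesis using card_N_split[of ?A y] n15 by simp
  qed
  then have "of_nat (card ?B) * 1 \<le> (\<Sum>y\<in>?B. card (N y \<inter> ?A) + (n - 5 - deg y))"
    by (rule sum_bounded_below)
  also have "\<dots> = (\<Sum>y\<in>?B. card (N y \<inter> ?A)) + (\<Sum>y\<in>?B. n - 5 - deg y)"
    by (rule sum.distrib)
  also have "(\<Sum>y\<in>?B. n - 5 - deg y) \<le> defect" using sub by (intro defect_ge) blast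
  also have "(\<Sum>y\<in>?B. card (N y \<inter> ?A)) = (\<Sum>x\<in>?A. card (N x \<inter> ?B))"
    using fB by (rule sum_cross) simp
  also have "\<dots> = (\<Sum>x\<in>?A - hubs. card (N x \<inter> ?B))"
  proof (rule sum.mono_neutral_right)
    show "\<forall>x\<in>?A - (?A - hubs). card (N x \<inter> ?B) = 0"
    proof
      fix x assume "x \<in> ?A - (?A - hubs)"
      then have "x \<in> hubs" "x \<in> ?A" by blast+
      then have "clN x = ?A" using hub_clN_eq[OF v, of x] by simp
      then have "N x \<inter> ?B = {}" by blast
      then show "card (N x \<inter> ?B) = 0" by simp
    qed
  qed auto
  also have "\<dots> \<le> of_nat (card (?A - hubs)) * 2"
  proof (rule sum_bounded_above)
    fix x assume "x \<in> ?A - hubs"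
    then have "x \<in> N v" using v by blast
    then have "card (N x - ?A) \<le> 2" using outside_le_2 dv by simp
    moreover have "card (N x \<inter> ?B) \<le> card (N x - ?A)" by (intro card_mono) auto
    ultimately show "card (N x \<inter> ?B) \<le> 2" by simp
  qed
  also have "card (?A - hubs) = n - 3 - card hubs" using sub cA by (subst card_Diff_subset) auto
  finally show ?thesis using cB card_mono[OF _ sub] cA n15 by simp
qed

text \<open>Closed neighbourhoods of size \<open>n - 3\<close> among \<open>2 * n - 8\<close>
  vertices share at least 2 vertices, and a shared hub would make them equal. If there are
  \<open>t\<close> common neighbours, each has degree at most \<open>t + 3\<close>, so
  \<open>t\<close> below \<open>n - 9\<close> makes \<open>defect\<close> large.\<close>

lemma common_nbrs:
  assumes v: "v \<in> hubs" and y: "y \<in> hubs" "y \<notin> clN v"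
  shows "2 \<le> card (N v \<inter> N y)" "N v \<inter> N y \<inter> hubs = {}"
    and "card hubs \<le> 18 + defect \<or> n - 9 \<le> card (N v \<inter> N y)"
proof -
  define I where "I = N v \<inter> N y"
  define t where "t = card I"
  have vV: "v \<in> V" and dv: "deg v = n - 4" using v by (auto simp: hubs_def)
  have yV: "y \<in> V" and dy: "deg y = n - 4" using y by (auto simp: hubs_def)
  have IV: "I \<subseteq> V" unfolding I_def using N_subset by blast
  have fI: "finite I" using IV finite_V by (rule finite_subset)
  have "v \<notin> N y" using y(2) nbrs_commute[of v E y] by simp
  then have I: "clN v \<inter> clN y = I" using y(2) unfolding I_def by blast
  have "card (clN v \<union> clN y) + t = (n - 3) + (n - 3)"
    unfolding t_def I[symmetric] using dv dy n15 card_Un_Int[of "clN v" "clN y"] by simp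
  moreover have "card (clN v \<union> clN y) \<le> 2 * n - 8"
    using clN_subset[OF vV] clN_subset[OF yV] card_V by (metis Un_least card_mono finite_V)
  ultimately have t2: "2 \<le> t" using n15 by linarith
  have disj: "I \<inter> hubs = {}"
  proof (rule ccontr)
    assume "I \<inter> hubs \<noteq> {}"
    then obtain u where u: "u \<in> I" "u \<in> hubs" by blast
    then have "clN u = clN v" "clN u = clN y"
      using clN_eq[OF v u(2)] clN_eq[OF y(1) u(2)] unfolding I_def by simp_all
    then have "clN y = clN v" by simp
    then show False using y(2) by blast
  qed
  show "2 \<le> card (N v \<inter> N y)" "N v \<inter> N y \<inter> hubs = {}"
    using t2 disj unfolding t_def I_def by auto
  show "card hubs \<le> 18 + defect \<or> n - 9 \<le> card (N v \<inter> N y)"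
  proof (rule disjCI)
    assume "\<not> n - 9 \<le> card (N v \<inter> N y)"
    then have tn: "t + 10 \<le> n" unfolding t_def I_def by linarith
    have "n - 8 - t \<le> n - 5 - deg u" if u: "u \<in> I" for u
    proof -
      have "N u \<subseteq> (I - {u}) \<union> ((N u - clN v) \<union> (N u - clN y))"
        using I self_notin_N[of u] by blast
      then have "deg u \<le> card ((I - {u}) \<union> ((N u - clN v) \<union> (N u - clN y)))"
        using fI by (intro card_mono) auto
      also have "\<dots> \<le> card (I - {u}) + (card (N u - clN v) + card (N u - clN y))"
        by (meson card_Un_le le_trans add_left_mono)
      also have "card (I - {u}) = t - 1" using u unfolding t_def by simp
      also have "card (N u - clN v) \<le> 2" using u dv unfolding I_def by (intro outside_le_2) auto
      also have "card (N u - clN y) \<le> 2" using u dy unfolding I_def by (intro outside_le_2) auto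
      finally show ?thesis using t2 by linarith
    qed
    then have "of_nat (card I) * (n - 8 - t) \<le> (\<Sum>u\<in>I. n - 5 - deg u)"
      by (rule sum_bounded_below)
    also have "\<dots> \<le> defect" using IV disj by (intro defect_ge) blast
    finally have eps: "t * (n - 8 - t) \<le> defect" by (simp add: t_def)
    have "card hubs + t = card (hubs \<union> I)"
      unfolding t_def using disj fI by (subst card_Un_disjoint) auto
    also have "\<dots> \<le> 2 * n - 8" using IV hubs_subset card_V card_mono[of V "hubs \<union> I"] by simp
    finally have ct: "card hubs + t \<le> 2 * n - 8" .
    obtain a where a: "t = a + 2" using t2 le_Suc_ex by (metis add.commute)
    obtain b where b: "n = t + 10 + b" using tn le_Suc_ex by metis
    \<comment> \<open>The right side exceeds the left by \<open>6 + t + a * b\<close>.\<close>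
    have "2 * n - 8 \<le> 18 + t * (n - 8 - t) + t" unfolding b a by (simp add: algebra_simps)
    then show "card hubs \<le> 18 + defect" using ct eps by linarith
  qed
qed

text \<open>Suppose there are more than \<open>18 + defect\<close> hubs, not all in
  \<open>clN v\<close>. Then at most two lie in \<open>clN v\<close>, and each of the others has at
  least \<open>n - 9\<close> neighbours in \<open>N v\<close>. But a vertex of \<open>N v\<close>
  has at most two neighbours outside \<open>clN v\<close>, too few for 17 such hubs.\<close>

lemma card_hubs_le: "card hubs \<le> 18 + defect \<or> 2 * card hubs \<le> n - 1 + 2 * defect"
proof (rule disjCI)
  assume A: "\<not> 2 * card hubs \<le> n - 1 + 2 * defect"
  show "card hubs \<le> 18 + defect"
  proof (rule ccontr)
    assume B: "\<not> card hubs \<le> 18 + defect"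
    then have "hubs \<noteq> {}" by auto
    then obtain v where v: "v \<in> hubs" by blast
    have vV: "v \<in> V" and dv: "deg v = n - 4" using v by (auto simp: hubs_def)
    let ?A = "clN v"
    have fA: "finite ?A" by simp
    have "\<not> hubs \<subseteq> ?A" using hubs_in_clN[OF v] A by linarith
    then obtain y where y: "y \<in> hubs" "y \<notin> ?A" by blast
    have dy: "deg y = n - 4" using y by (auto simp: hubs_def)
    have "N v \<inter> N y \<noteq> {}" using common_nbrs(1)[OF v y] by auto
    then obtain u where u: "u \<in> N v" "u \<in> N y" "u \<notin> hubs" using common_nbrs(2)[OF v y] by blast
    \<comment> \<open>Hubs in \<open>clN v\<close> share the closed neighbourhood of
      \<open>v\<close>, so they are adjacent to \<open>u\<close> and miss \<open>clN y\<close>; as a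
      neighbour of the hub \<open>y\<close>, the vertex \<open>u\<close> has at most two such
      neighbours.\<close>
    have "hubs \<inter> ?A \<subseteq> N u - clN y"
    proof
      fix z assume z: "z \<in> hubs \<inter> ?A"
      then have cz: "clN z = ?A" using hub_clN_eq[OF v, of z] by simp
      then have "u \<in> clN z" using u(1) by simp
      then have "u \<in> N z" using u(3) z by auto
      then have "z \<in> N u" using nbrs_commute[of u E z] by simp
      moreover have "z \<notin> clN y"
      proof
        assume "z \<in> clN y"
        then have "clN z = clN y" using hub_clN_eq[OF y(1), of z] z by simp
        then have "y \<in> clN z" by simp
        then show False using cz y(2) by simp
      qed
      ultimately show "z \<in> N u - clN y" by blast
    qed
    then have "card (hubs \<inter> ?A) \<le> card (N u - clN y)" by (intro card_mono) auto
    then have c2: "card (hubs \<inter> ?A) \<le> 2" using outside_le_2[OF u(2)] dy by simp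
    have "n - 9 \<le> card (N z \<inter> N v)" if "z \<in> hubs - ?A" for z
      using common_nbrs(3)[OF v, of z] that B by (auto simp: Int_commute)
    then have "of_nat (card (hubs - ?A)) * (n - 9) \<le> (\<Sum>z\<in>hubs - ?A. card (N z \<inter> N v))"
      by (rule sum_bounded_below)
    also have "\<dots> = (\<Sum>x\<in>N v. card (N x \<inter> (hubs - ?A)))" by (rule sum_cross) auto
    also have "\<dots> \<le> of_nat (card (N v)) * 2"
    proof (rule sum_bounded_above)
      fix x assume "x \<in> N v"
      then have "card (N x - ?A) \<le> 2" using outside_le_2 dv by simp
      moreover have "card (N x \<inter> (hubs - ?A)) \<le> card (N x - ?A)" by (intro card_mono) auto
      ultimately show "card (N x \<inter> (hubs - ?A)) \<le> 2" by simp
    qed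
    finally have "card (hubs - ?A) * (n - 9) \<le> (n - 4) * 2" using dv by simp
    moreover have "17 \<le> card (hubs - ?A)"
      using c2 B card_Diff_subset_Int[of hubs ?A] by simp
    then have "17 * (n - 9) \<le> card (hubs - ?A) * (n - 9)" by (rule mult_le_mono1)
    ultimately show False using n15 by linarith
  qed
qed

lemma size_bound: "2 * card E \<le> (n - 1) * (n - 2) + (n - 7) * (n - 8) + 2 * ((n - 37) div 4)"
proof -
  define m where "m = n - 15"
  then have m: "n = m + 15" using n15 by simp
  \<comment> \<open>This is where 18 comes from: it is the degree sum of cliques on
    \<open>n - 1\<close> and \<open>n - 7\<close> vertices minus that of a graph with all
    \<open>2 * n - 8\<close> degrees equal to \<open>n - 5\<close>.\<close>
  have eq: "(n - 1) * (n - 2) + (n - 7) * (n - 8) = (2 * n - 8) * (n - 5) + 18"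
    unfolding m by (simp add: algebra_simps)
  have "2 * n - 8 = 2 * (n - 4)" by simp
  then have even: "(2 * n - 8) * (n - 5) = 2 * ((n - 4) * (n - 5))" by (simp only: mult.assoc)
  define F where "F = (n - 4) * (n - 5)"
  have s: "2 * card E + defect = 2 * F + card hubs" using size_eq even F_def by simp
  from card_hubs_le show ?thesis
  proof
    assume "card hubs \<le> 18 + defect"
    then show ?thesis using s eq even by (simp add: F_def)
  next
    assume "2 * card hubs \<le> n - 1 + 2 * defect"
    then have "4 * card E \<le> 4 * F + (n - 1)" using s by linarith
    \<comment> \<open>\<open>(n - 1) div 4\<close> equals \<open>9 + (n - 37) div 4\<close> from
      \<open>n = 37\<close> on and is at most 8 before, where the truncated difference is 0.\<close>
    then have "card E \<le> F + 9 + (n - 37) div 4" by linarith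
    then show ?thesis using eq even by (simp add: F_def)
  qed
qed

end

section \<open>Upper bound by induction on \<open>k\<close>\<close>

lemma has_T3_mono: "has_T3 n E \<Longrightarrow> E \<subseteq> F \<Longrightarrow> has_T3 n F"
proof -
  assume "has_T3 n E" "E \<subseteq> F"
  then have "nbrs E x \<subseteq> nbrs F x" for x by (auto simp: nbrs_def)
  then show ?thesis using \<open>has_T3 n E\<close> unfolding has_T3_def by (meson in_mono Diff_mono order_trans subset_refl)
qed

theorem T3_free_size_bound:
  assumes "15 \<le> n" "simple_graph V E" "\<not> has_T3 n E" "card V = k * (n - 1) + (n - 7)"
  shows "2 * card E \<le> k * ((n - 1) * (n - 2)) + (n - 7) * (n - 8) + 2 * ((n - 37) div 4)"
  using assms(2-4)
proof (induction k arbitrary: V E)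
  case 0
  interpret ugraph V E by unfold_locales (rule 0)
  have cV: "card V = n - 7" using 0 by simp
  have "deg x \<le> n - 8" if "x \<in> V" for x
  proof -
    have "N x \<subseteq> V - {x}" using N_subset[of x] self_notin_N[of x] by blast
    then have "deg x \<le> card (V - {x})" by (intro card_mono) auto
    then show ?thesis using that cV by simp
  qed
  then have "(\<Sum>x\<in>V. deg x) \<le> of_nat (card V) * (n - 8)" by (rule sum_bounded_above)
  then show ?case using handshake cV by simp
next
  case (Suc k)
  interpret T3_free V E n
    by unfold_locales (use Suc.prems assms(1) in auto)
  show ?case
  proof (cases reducible)
    case True
    then obtain W where W: "W \<subseteq> V" "card W = n - 1"
      and le: "(\<Sum>x\<in>W. deg x + card (N x - W)) \<le> (n - 1) * (n - 2)"
      unfolding reducible_def by blast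
    let ?E' = "{e \<in> E. e \<subseteq> V - W}"
    have "finite W" using W(1) finite_V by (rule finite_subset)
    then have "card (V - W) = k * (n - 1) + (n - 7)"
      using W Suc.prems(3) by (simp add: card_Diff_subset)
    moreover have "\<not> has_T3 n ?E'" using free has_T3_mono[of n ?E' E] by blast
    ultimately have "2 * card ?E' \<le> k * ((n - 1) * (n - 2)) + (n - 7) * (n - 8) + 2 * ((n - 37) div 4)"
      using Suc.IH[OF delete_vertices(1)[OF W(1)]] by blast
    then show ?thesis using delete_vertices(2)[OF W(1)] le by simp
  next
    case False
    show ?thesis
    proof (cases k)
      case 0
      then have "card V = 2 * n - 8" using Suc.prems(3) assms(1) by simp
      then interpret irreducible_T3_free V E n
        by unfold_locales (use False in auto)
      show ?thesis using size_bound 0 by simp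
    next
      case (Suc j)
      define m where "m = n - 15"
      then have m: "n = m + 15" using n15 by simp
      have "deg x \<le> n - 4" for x
        using irreducible_structure(1)[OF False] Suc.prems(3) by simp
      then have "(\<Sum>x\<in>V. deg x) \<le> of_nat (card V) * (n - 4)" by (intro sum_bounded_above)
      then have "2 * card E \<le> (Suc (Suc j) * (n - 1) + (n - 7)) * (n - 4)"
        using handshake Suc.prems(3) Suc by simp
      \<comment> \<open>With \<open>K = Suc (Suc j)\<close> the right side exceeds the left by
        \<open>2 * K * (n - 1) - 4 * (n - 7)\<close>. For \<open>K = 1\<close> this would be
        negative, hence the separate treatment of that case.\<close>
      also have "\<dots> \<le> Suc (Suc j) * ((n - 1) * (n - 2)) + (n - 7) * (n - 8)"
        unfolding m by (simp add: algebra_simps)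
      finally show ?thesis using Suc by simp
    qed
  qed
qed

section \<open>Lower bound: disjoint cliques and the exceptional graph\<close>

definition clique :: "'a set \<Rightarrow> 'a set set" where
  "clique S = {{x, y} | x y. x \<in> S \<and> y \<in> S \<and> x \<noteq> y}"

lemma nbrs_clique: "nbrs (clique S) x = (if x \<in> S then S - {x} else {})"
  by (auto simp: nbrs_def clique_def doubleton_eq_iff)

lemma simple_graph_clique: "finite S \<Longrightarrow> simple_graph S (clique S)"
  by (auto simp: simple_graph_def clique_def)

lemma card_clique: "finite S \<Longrightarrow> 2 * card (clique S) = card S * (card S - 1)"
proof -
  assume S: "finite S"
  interpret ugraph S "clique S" by unfold_locales (rule simple_graph_clique[OF S])
  show ?thesis using handshake by (simp add: nbrs_clique)
qed

lemma simple_graph_Un: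
  "simple_graph V E \<Longrightarrow> simple_graph V' E' \<Longrightarrow> simple_graph (V \<union> V') (E \<union> E')"
  unfolding simple_graph_def by (metis Un_iff finite_UnI)

text \<open>A copy occupies \<open>n\<close> distinct vertices; this excludes copies in cliques on
  fewer than \<open>n\<close> vertices.\<close>

lemma has_T3_card:
  assumes "simple_graph V E" "5 \<le> n" "has_T3 n E"
  shows "n \<le> card V"
proof -
  interpret ugraph V E by unfold_locales (rule assms)
  obtain v u S L where T: "u \<in> N v" "S \<subseteq> N v - {u}" "L \<subseteq> N u - {v}" "S \<inter> L = {}"
    "card S = n - 5" "card L = 3"
    using assms(3) unfolding has_T3_def by blast
  have fin: "finite S" "finite L" using T(2,3) finite_N finite_subset finite_Diff by metis+
  have "v \<notin> S \<union> L" "u \<notin> S \<union> L" "v \<noteq> u"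
    using T self_notin_N[of v] self_notin_N[of u] by blast+
  then have "card (insert v (insert u (S \<union> L))) = n"
    using T fin assms(2) by (simp add: card_Un_disjoint)
  moreover have "insert v (insert u (S \<union> L)) \<subseteq> V"
    using T N_subset[of u] N_subset[of v] N_D[OF T(1)] by blast
  ultimately show ?thesis by (metis card_mono finite_V)
qed

text \<open>The tree is connected: the part that holds the edge between the centres also holds all
  leaf edges.\<close>

lemma has_T3_Un:
  assumes G: "simple_graph V E" and G': "simple_graph V' E'" and disj: "V \<inter> V' = {}"
    and T: "has_T3 n (E \<union> E')"
  shows "has_T3 n E \<or> has_T3 n E'"
proof -
  interpret G: ugraph V E by unfold_locales (rule G)
  interpret G': ugraph V' E' by unfold_locales (rule G')
  have Un: "nbrs (E \<union> E') x = nbrs E x \<union> nbrs E' x" for x by (auto simp: nbrs_def)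
  have out: "nbrs E x = {}" if "x \<notin> V" for x using that G.N_D[of _ x] by blast
  have out': "nbrs E' x = {}" if "x \<notin> V'" for x using that G'.N_D[of _ x] by blast
  obtain v u S L where T: "u \<in> nbrs (E \<union> E') v" "S \<subseteq> nbrs (E \<union> E') v - {u}"
    "L \<subseteq> nbrs (E \<union> E') u - {v}" "S \<inter> L = {}" "card S = n - 5" "card L = 3"
    using assms(4) unfolding has_T3_def by blast
  show ?thesis
  proof (cases "u \<in> nbrs E v")
    case True
    then have "v \<notin> V'" "u \<notin> V'" using G.N_D disj by blast+
    then have "nbrs (E \<union> E') v = nbrs E v" "nbrs (E \<union> E') u = nbrs E u" using Un out' by auto
    then have "has_T3 n E" unfolding has_T3_def using T True by metis
    then show ?thesis ..
  next
    case False
    then have uv: "u \<in> nbrs E' v" using T(1) Un by blast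
    then have "v \<notin> V" "u \<notin> V" using G'.N_D disj by blast+
    then have "nbrs (E \<union> E') v = nbrs E' v" "nbrs (E \<union> E') u = nbrs E' u" using Un out by auto
    then have "has_T3 n E'" unfolding has_T3_def using T uv by metis
    then show ?thesis ..
  qed
qed

text \<open>The new cliques occupy consecutive intervals from \<open>m\<close> on, so the vertex set
  keeps the form \<open>{0..<p}\<close> used by \<open>ex\<close>.\<close>

lemma add_cliques:
  assumes n: "6 \<le> n" and G: "simple_graph {0..<m} E" "\<not> has_T3 n E"
  shows "\<exists>F. simple_graph {0..<m + k * (n - 1)} F \<and> \<not> has_T3 n F \<and>
    2 * card F = 2 * card E + k * ((n - 1) * (n - 2))"
proof (induction k)
  case 0
  then show ?case using G by auto
next
  case (Suc k)
  then obtain F where F: "simple_graph {0..<m + k * (n - 1)} F" "\<not> has_T3 n F"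
    "2 * card F = 2 * card E + k * ((n - 1) * (n - 2))" by blast
  let ?S = "{m + k * (n - 1)..<m + Suc k * (n - 1)}"
  have Q: "simple_graph ?S (clique ?S)" by (rule simple_graph_clique) simp
  have cS: "card ?S = n - 1" by simp
  have U: "{0..<m + k * (n - 1)} \<union> ?S = {0..<m + Suc k * (n - 1)}" by auto
  have "simple_graph {0..<m + Suc k * (n - 1)} (F \<union> clique ?S)"
    using simple_graph_Un[OF F(1) Q] U by simp
  moreover have "\<not> has_T3 n (F \<union> clique ?S)"
  proof
    assume "has_T3 n (F \<union> clique ?S)"
    then have "has_T3 n (clique ?S)" using has_T3_Un[OF F(1) Q] F(2) by auto
    then have "n \<le> card ?S" using has_T3_card[OF Q] n by simp
    then show False using cS n by simp
  qed
  moreover have "card (F \<union> clique ?S) = card F + card (clique ?S)"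
  proof (rule card_Un_disjoint)
    interpret F: ugraph "{0..<m + k * (n - 1)}" F by unfold_locales (rule F)
    interpret Q: ugraph ?S "clique ?S" by unfold_locales (rule Q)
    show "finite F" "finite (clique ?S)" by (rule F.finite_E Q.finite_E)+
    show "F \<inter> clique ?S = {}"
    proof -
      have "e \<noteq> {}" if "e \<in> clique ?S" for e using that unfolding clique_def by blast
      moreover have "e = {}" if "e \<in> F" "e \<in> clique ?S" for e
      proof -
        have "e \<subseteq> {0..<m + k * (n - 1)} \<inter> ?S" using that F.E_subset Q.E_subset by blast
        moreover have "{0..<m + k * (n - 1)} \<inter> ?S = {}" by auto
        ultimately show ?thesis by simp
      qed
      ultimately show ?thesis by blast
    qed
  qed
  moreover have "2 * card (clique ?S) = (n - 1) * (n - 2)"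
    using card_clique[of ?S] cS by (simp add: numeral_2_eq_2)
  ultimately show ?case using F(3) by (intro exI[of _ "F \<union> clique ?S"]) simp
qed

text \<open>
  Two cliques \<open>A\<close> and \<open>B\<close> with \<open>n - 3\<close> and \<open>n - 5\<close> vertices.  Every vertex of \<open>B\<close> gets one
  neighbour among the first \<open>s\<close> vertices of \<open>A\<close>, so that each of these has two neighbours in
  \<open>B\<close> (the last one has only one if \<open>n\<close> is even).  To bring their degrees down to \<open>n - 5\<close>, the
  edges \<open>Q\<close> of a cycle with long chords are removed, which is the cheapest way to lower \<open>s\<close>
  degrees by 3.  The other vertices of \<open>A\<close> keep degree \<open>n - 4\<close> and have all neighbours in \<open>A\<close>.
\<close>

lemma exceptional_graph:
  assumes n: "37 \<le> n"
  shows "\<exists>E. simple_graph {0..<2 * n - 8} E \<and> \<not> has_T3 n E \<and>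
    (n - 1) * (n - 2) + (n - 7) * (n - 8) + 2 * ((n - 37) div 4) \<le> 2 * card E"
proof -
  \<comment> \<open>\<open>s\<close> is half of \<open>n - 5\<close>, rounded up; \<open>h\<close>
    is the length of the chords and \<open>c\<close> their number, chosen so that removing
    \<open>s + c\<close> edges gives the required size.\<close>
  define s where "s = (n - 4) div 2"
  define h where "h = s div 2"
  define c where "c = n - 4 - (n - 1) div 4 - s"
  have s: "2 * s \<le> n - 4" "n - 5 \<le> 2 * s" unfolding s_def by linarith+
  have h: "2 * h \<le> s" "s \<le> 2 * h + 1" "8 \<le> h" unfolding h_def s_def using n by linarith+
  \<comment> \<open>As \<open>h \<le> c\<close>, the chords reach all vertices below
    \<open>h + c\<close>. At most the vertex \<open>s - 1\<close> is missed, and then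
    \<open>n = 2 * s + 4\<close>, so that it has only one neighbour in \<open>B\<close>.\<close>
  have "h \<le> c \<and> h + c \<le> s \<and> s \<le> h + c + 1 \<and> (h + c < s \<longrightarrow> n = 2 * s + 4) \<and>
    s + c + (n - 1) div 4 = n - 4"
  proof -
    define q where "q = (n - 1) div 4"
    have "n = 4 * q + 1 \<or> n = 4 * q + 2 \<or> n = 4 * q + 3 \<or> n = 4 * q + 4" "9 \<le> q"
      unfolding q_def using n by linarith+
    then show ?thesis
    proof (elim disjE)
      assume e: "n = 4 * q + 1"
      then have "s = 2 * q - 2" unfolding s_def by simp
      moreover from this have "h = q - 1" unfolding h_def by simp
      ultimately show ?thesis using e \<open>9 \<le> q\<close> unfolding c_def q_def[symmetric] by simp linarith
    next
      assume e: "n = 4 * q + 2"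
      then have "s = 2 * q - 1" unfolding s_def by simp
      moreover from this have "h = q - 1" unfolding h_def using \<open>9 \<le> q\<close> by simp
      ultimately show ?thesis using e \<open>9 \<le> q\<close> unfolding c_def q_def[symmetric] by simp presburger
    next
      assume e: "n = 4 * q + 3"
      then have "s = 2 * q - 1" unfolding s_def using \<open>9 \<le> q\<close> by simp
      moreover from this have "h = q - 1" unfolding h_def using \<open>9 \<le> q\<close> by simp
      ultimately show ?thesis using e \<open>9 \<le> q\<close> unfolding c_def q_def[symmetric] by simp linarith
    next
      assume e: "n = 4 * q + 4"
      then have "s = 2 * q" unfolding s_def by simp
      moreover from this have "h = q" unfolding h_def by simp
      ultimately show ?thesis using e \<open>9 \<le> q\<close> unfolding c_def q_def[symmetric] by simp
    qed
  qed
  then have c: "h \<le> c" "h + c \<le> s" "s \<le> h + c + 1" "h + c < s \<Longrightarrow> n = 2 * s + 4"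
    "s + c + (n - 1) div 4 = n - 4"
    by blast+
  define A where "A = {0..<n - 3}"
  define B where "B = {n - 3..<2 * n - 8}"
  define succ where "succ i = (if Suc i = s then 0 else Suc i)" for i
  define Q where "Q = (\<lambda>i. {i, succ i}) ` {..<s} \<union> (\<lambda>i. {i, i + h}) ` {..<c}"
  define M where "M = (\<lambda>j. {j div 2, n - 3 + j}) ` {..<n - 5}"
  define E where "E = (clique A - Q) \<union> clique B \<union> M"
  have cA: "card A = n - 3" and cB: "card B = n - 5" and fin: "finite A" "finite B"
    using n unfolding A_def B_def by auto
  have AB: "A \<inter> B = {}" "A \<union> B = {0..<2 * n - 8}" using n unfolding A_def B_def by auto
  have M_AB: "j div 2 \<in> A" "n - 3 + j \<in> B" if "j < n - 5" for j
    using that n unfolding A_def B_def by auto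
  have G: "simple_graph {0..<2 * n - 8} E"
    unfolding simple_graph_def
  proof (intro conjI ballI)
    fix e assume "e \<in> E"
    then consider "e \<in> clique A" | "e \<in> clique B" | j where "j < n - 5" "e = {j div 2, n - 3 + j}"
      unfolding E_def M_def by blast
    then show "\<exists>x y. x \<in> {0..<2 * n - 8} \<and> y \<in> {0..<2 * n - 8} \<and> x \<noteq> y \<and> e = {x, y}"
    proof cases
      case 3
      then show ?thesis using M_AB[of j] AB by (metis UnI1 UnI2 disjoint_iff)
    qed (unfold clique_def AB(2)[symmetric], blast+)
  qed simp
  interpret ugraph "{0..<2 * n - 8}" E by unfold_locales (rule G)

  have cliqueD: "e \<subseteq> S \<and> e \<noteq> {}" if "e \<in> clique S" for e S using that unfolding clique_def by blast
  have "card Q \<le> card ((\<lambda>i. {i, succ i}) ` {..<s}) + card ((\<lambda>i. {i, i + h}) ` {..<c})"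
    unfolding Q_def by (rule card_Un_le)
  also have "\<dots> \<le> card {..<s} + card {..<c}" by (intro add_mono card_image_le) auto
  finally have cQ: "card Q \<le> s + c" by simp
  have cM: "card M = n - 5"
  proof -
    have "inj_on (\<lambda>j. {j div 2, n - 3 + j}) {..<n - 5}"
    proof (rule inj_onI)
      fix i j assume ij: "i \<in> {..<n - 5}" "j \<in> {..<n - 5}" "{i div 2, n - 3 + i} = {j div 2, n - 3 + j}"
      then have "i div 2 < n - 3" "j div 2 < n - 3" by auto
      then show "i = j" using ij(3) by (auto simp: doubleton_eq_iff)
    qed
    from card_image[OF this] show ?thesis unfolding M_def by simp
  qed
  have fE: "finite (clique A)" "finite (clique B)" "finite M" "finite Q"
    using ugraph.finite_E ugraph.intro simple_graph_clique fin unfolding M_def Q_def by blast+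
  have "M \<inter> (clique A \<union> clique B) = {}"
  proof -
    have "\<not> e \<subseteq> A \<and> \<not> e \<subseteq> B" if "e \<in> M" for e
      using that M_AB AB(1) unfolding M_def by blast
    then show ?thesis using cliqueD by blast
  qed
  then have "card E = card (clique A - Q) + card (clique B) + card M"
    unfolding E_def using fE cliqueD AB(1) by (subst card_Un_disjoint; (subst card_Un_disjoint)?) blast+
  moreover have "card (clique A) - card Q \<le> card (clique A - Q)" by (rule diff_card_le_card_Diff) (rule fE)
  ultimately have "card (clique A) + card (clique B) + (n - 5) \<le> card E + (s + c)"
    using cQ cM by linarith
  from mult_le_mono2[OF this, of 2]
  have "2 * card (clique A) + 2 * card (clique B) + 2 * (n - 5) \<le> 2 * card E + 2 * (s + c)"
    by (simp only: distrib_left)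
  moreover have "2 * card (clique A) = (n - 3) * (n - 4)" "2 * card (clique B) = (n - 5) * (n - 6)"
    using card_clique[OF fin(1)] card_clique[OF fin(2)] cA cB by simp_all
  moreover define R where "R = (n - 3) * (n - 4) + (n - 5) * (n - 6) + 2 * (n - 5)"
  ultimately have R: "R \<le> 2 * card E + 2 * (s + c)"
    by (simp only:)
  define P where "P = (n - 1) * (n - 2) + (n - 7) * (n - 8)"
  have "P + 2 * (n - 13) = R"
  proof -
    define m where "m = n - 37"
    then have m: "n = m + 37" using n by simp
    show ?thesis unfolding P_def R_def m by (simp add: algebra_simps)
  qed
  moreover define t where "t = (n - 37) div 4"
  \<comment> \<open>Here \<open>(n - 1) div 4 = 9 + t\<close>.\<close>
  have "s + c + t = n - 13"
    unfolding t_def using c(5) n by linarith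
  ultimately have "P + 2 * t \<le> 2 * card E"
    using R by simp
  then have size: "(n - 1) * (n - 2) + (n - 7) * (n - 8) + 2 * ((n - 37) div 4) \<le> 2 * card E"
    unfolding P_def t_def .

  have E_iff: "{x, y} \<in> E \<longleftrightarrow> x \<in> A \<and> y \<in> A \<and> x \<noteq> y \<and> {x, y} \<notin> Q \<or> x \<in> B \<and> y \<in> B \<and> x \<noteq> y \<or>
    (\<exists>j<n - 5. {x, y} = {j div 2, n - 3 + j})" for x y
    unfolding E_def M_def clique_def by (auto simp: doubleton_eq_iff)
  have N_A: "N x \<subseteq> {y \<in> A. y \<noteq> x \<and> {x, y} \<notin> Q} \<union> {y \<in> B. y = n - 3 + 2 * x \<or> y = n - 3 + 2 * x + 1}"
    if x: "x \<in> A" for x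
  proof
    fix y assume "y \<in> N x"
    then consider "y \<in> A \<and> x \<noteq> y \<and> {x, y} \<notin> Q" | j where "j < n - 5" "{x, y} = {j div 2, n - 3 + j}"
      using x AB(1) unfolding nbrs_def E_iff by blast
    then show "y \<in> {y \<in> A. y \<noteq> x \<and> {x, y} \<notin> Q} \<union> {y \<in> B. y = n - 3 + 2 * x \<or> y = n - 3 + 2 * x + 1}"
    proof cases
      case 2
      then have "x = j div 2" "y = n - 3 + j"
        using x M_AB[of j] AB(1) by (auto simp: doubleton_eq_iff)
      moreover have "j = 2 * (j div 2) \<or> j = 2 * (j div 2) + 1" by linarith
      ultimately show ?thesis using M_AB[of j] 2 by auto
    qed auto
  qed
  have N_B: "N x \<subseteq> (B - {x}) \<union> {(x - (n - 3)) div 2}" if x: "x \<in> B" for x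
  proof
    fix y assume "y \<in> N x"
    then consider "y \<in> B \<and> x \<noteq> y" | j where "j < n - 5" "{x, y} = {j div 2, n - 3 + j}"
      using x AB(1) unfolding nbrs_def E_iff by blast
    then show "y \<in> (B - {x}) \<union> {(x - (n - 3)) div 2}"
    proof cases
      case 2
      then have "y = j div 2" "x = n - 3 + j"
        using x M_AB[of j] AB(1) by (auto simp: doubleton_eq_iff)
      then show ?thesis by auto
    qed auto
  qed
  have deg_B: "deg x \<le> n - 5" if "x \<in> B" for x
  proof -
    have "deg x \<le> card ((B - {x}) \<union> {(x - (n - 3)) div 2})"
      using N_B[OF that] fin by (intro card_mono) auto
    also have "\<dots> \<le> card (B - {x}) + card {(x - (n - 3)) div 2}" by (rule card_Un_le)
    finally show ?thesis using that cB n by simp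
  qed
  have deg_low: "deg x \<le> n - 5" if x: "x < s" for x
  proof -
    have xA: "x \<in> A" using x s n unfolding A_def by auto
    define pred where "pred = (if x = 0 then s - 1 else x - 1)"
    have sQ: "{x, succ x} \<in> Q" unfolding Q_def using x by blast
    have "succ pred = x" "pred < s" using x unfolding pred_def succ_def by auto
    then have pQ: "{x, pred} \<in> Q" unfolding Q_def using x by (auto simp: insert_commute)
    have ps: "pred \<in> A" "succ x \<in> A" "pred \<noteq> x" "succ x \<noteq> x" "pred \<noteq> succ x"
      using x s h n unfolding pred_def succ_def A_def by auto
    define P where "P = {y \<in> B. y = n - 3 + 2 * x \<or> y = n - 3 + 2 * x + 1}"
    have fP: "finite P" unfolding P_def using fin by simp
    have "P \<subseteq> {n - 3 + 2 * x, n - 3 + 2 * x + 1}" unfolding P_def by blast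
    then have "card P \<le> card {n - 3 + 2 * x, n - 3 + 2 * x + 1}" by (intro card_mono) auto
    then have cP: "card P \<le> 2" by simp
    have bound: "deg x \<le> card (A - R) + card P" if R: "\<And>y. y \<in> R \<Longrightarrow> y = x \<or> {x, y} \<in> Q" for R
    proof -
      have "N x \<subseteq> (A - R) \<union> P" using N_A[OF xA] R unfolding P_def by blast
      then have "deg x \<le> card ((A - R) \<union> P)" using fin fP by (intro card_mono) auto
      also have "\<dots> \<le> card (A - R) + card P" by (rule card_Un_le)
      finally show ?thesis .
    qed
    \<comment> \<open>Of the \<open>n - 4\<close> other vertices of \<open>A\<close>, a vertex below
      \<open>h + c\<close> loses three and gains at most two in \<open>B\<close>; the remaining
      vertex loses two and gains at most one.\<close>
    show ?thesis
    proof (cases "x < h + c")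
      case True
      define d where "d = (if x < c then x + h else x - h)"
      have "{x, d} \<in> Q"
      proof (cases "x < c")
        case True
        then show ?thesis unfolding Q_def d_def by auto
      next
        case False
        then have xh: "x - h \<in> {..<c}" "x - h + h = x" using \<open>x < h + c\<close> c(1) by auto
        have "{x - h, x} \<in> Q"
          unfolding Q_def using imageI[OF xh(1), of "\<lambda>i. {i, i + h}"] xh(2) by simp
        then show ?thesis using False by (simp add: d_def insert_commute)
      qed
      moreover have d: "d \<in> A" "d \<noteq> x" "d \<noteq> pred" "d \<noteq> succ x"
        using True x s h c n unfolding d_def pred_def succ_def A_def by (auto split: if_splits)
      ultimately have "deg x \<le> card (A - {x, succ x, pred, d}) + card P"
        using sQ pQ by (intro bound) auto
      moreover have "card (A - {x, succ x, pred, d}) = n - 3 - 4"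
        using xA ps d cA fin by (subst card_Diff_subset) auto
      ultimately show ?thesis using cP n by linarith
    next
      case False
      then have "n = 2 * s + 4" "x = s - 1" using c x by linarith+
      then have "n - 3 + 2 * x + 1 \<notin> B" using h unfolding B_def by auto
      then have "P \<subseteq> {n - 3 + 2 * x}" unfolding P_def by blast
      then have "card P \<le> card {n - 3 + 2 * x}" by (intro card_mono) auto
      moreover have "deg x \<le> card (A - {x, succ x, pred}) + card P"
        using sQ pQ by (intro bound) auto
      moreover have "card (A - {x, succ x, pred}) = n - 3 - 3"
        using xA ps cA fin by (subst card_Diff_subset) auto
      ultimately show ?thesis using n by simp
    qed
  qed
  have N_high: "N x \<subseteq> A - {x}" if x: "x \<in> A" "s \<le> x" for x
  proof -
    have "n - 3 + 2 * x \<notin> B" using s x n unfolding B_def by auto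
    then show ?thesis using N_A[OF x(1)] s x n unfolding B_def by auto
  qed
  \<comment> \<open>A centre \<open>v\<close> needs degree \<open>n - 4\<close>, so it lies in
    \<open>A\<close> beyond the first \<open>s\<close> vertices. Then \<open>u\<close> and
    \<open>S\<close> use up \<open>A - {v}\<close>, and \<open>L\<close> would have to fit into the
    at most two neighbours of \<open>u\<close> in \<open>B\<close>.\<close>
  have "\<not> has_T3 n E"
  proof
    assume "has_T3 n E"
    then obtain v u S L where T: "u \<in> N v" "S \<subseteq> N v - {u}" "L \<subseteq> N u - {v}"
      "S \<inter> L = {}" "card S = n - 5" "card L = 3"
      unfolding has_T3_def by blast
    have "S \<subseteq> N v" using T(2) by blast
    then have fS: "finite S" by (rule finite_subset) simp
    have "u \<notin> S" using T(2) by blast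
    then have cI: "card (insert u S) = n - 4" using T(5) fS n by simp
    have sub: "insert u S \<subseteq> N v" using T(1,2) by blast
    then have "n - 4 \<le> deg v" using cI card_mono[OF finite_N sub] by simp
    then have "\<not> deg v \<le> n - 5" using n by linarith
    moreover have "v \<in> A \<union> B" using N_D[OF T(1)] AB by blast
    ultimately have v: "v \<in> A" "s \<le> v" using deg_B deg_low by (blast, meson not_le)
    have eq: "insert u S = A - {v}"
    proof (rule card_subset_eq)
      show "finite (A - {v})" using fin by simp
      show "insert u S \<subseteq> A - {v}" using sub N_high[OF v] by blast
      show "card (insert u S) = card (A - {v})" using cI cA v by simp
    qed
    then have uA: "u \<in> A" by blast
    have "x \<notin> A" if "x \<in> L" for x
    proof -
      have "x \<noteq> v" "x \<noteq> u" "x \<notin> S" using that T(3,4) by auto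
      then have "x \<notin> insert u S" by simp
      then show ?thesis unfolding eq using \<open>x \<noteq> v\<close> by simp
    qed
    then have "L \<subseteq> {n - 3 + 2 * u, n - 3 + 2 * u + 1}" using T(3) N_A[OF uA] by blast
    then have "card L \<le> card {n - 3 + 2 * u, n - 3 + 2 * u + 1}" by (intro card_mono) auto
    then show False using T(6) by simp
  qed
  then show ?thesis using G size by blast
qed

section \<open>The exact value from both bounds\<close>

theorem theorem4p5:
  fixes p n k :: nat
  assumes "n \<ge> 15" and "p \<ge> n" and "k \<ge> 1" and "p = k * (n - 1) + n - 7"
  shows "real (ex p (T3_vertices n) (T3_edges n)) =
           (real (n - 2) * real p - 6 * (real n - 7)) / 2
           + real_of_int (max \<lfloor>(real n - 37) / 4\<rfloor> 0)"
proof -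
  define M where "M = (n - 37) div 4"
  define sizes where "sizes = {card E | E. simple_graph {0..<p} E \<and>
    \<not> contains_copy {0..<p} E (T3_vertices n) (T3_edges n)}"
  have n6: "6 \<le> n" using assms(1) by simp
  have sizes: "sizes = {card E | E. simple_graph {0..<p} E \<and> \<not> has_T3 n E}"
    unfolding sizes_def using contains_T3_iff[of "{0..<p}" _ n, OF _ n6] by blast
  have p: "p = k * (n - 1) + (n - 7)" using assms by simp
  have ub: "2 * z \<le> k * ((n - 1) * (n - 2)) + (n - 7) * (n - 8) + 2 * M" if "z \<in> sizes" for z
    using that T3_free_size_bound[OF assms(1), of "{0..<p}" _ k] p unfolding sizes M_def by auto
  have "\<exists>z\<in>sizes. k * ((n - 1) * (n - 2)) + (n - 7) * (n - 8) + 2 * M \<le> 2 * z"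
  \<comment> \<open>From \<open>n = 37\<close> on, the exceptional graph replaces the clique on
    \<open>n - 7\<close> vertices together with one clique on \<open>n - 1\<close> vertices.\<close>
  proof (cases "37 \<le> n")
    case True
    from exceptional_graph[OF this] obtain E where E: "simple_graph {0..<2 * n - 8} E" "\<not> has_T3 n E"
      "(n - 1) * (n - 2) + (n - 7) * (n - 8) + 2 * M \<le> 2 * card E"
      unfolding M_def by blast
    obtain F where F: "simple_graph {0..<2 * n - 8 + (k - 1) * (n - 1)} F" "\<not> has_T3 n F"
      "2 * card F = 2 * card E + (k - 1) * ((n - 1) * (n - 2))"
      using add_cliques[OF n6 E(1,2), of "k - 1"] by blast
    obtain k' where k': "k = Suc k'" using assms(3) by (cases k) auto
    have "2 * n - 8 + (k - 1) * (n - 1) = p" using p assms(1) k' by simp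
    then have "card F \<in> sizes" using F unfolding sizes by blast
    then show ?thesis using F(3) E(3) k' by force
  next
    case False
    have Q: "simple_graph {0..<n - 7} (clique {0..<n - 7})" by (rule simple_graph_clique) simp
    have "\<not> has_T3 n (clique {0..<n - 7})" using has_T3_card[OF Q, of n] assms(1) by auto
    then obtain F where F: "simple_graph {0..<n - 7 + k * (n - 1)} F" "\<not> has_T3 n F"
      "2 * card F = 2 * card (clique {0..<n - 7}) + k * ((n - 1) * (n - 2))"
      using add_cliques[OF n6 Q, of k] by blast
    have "n - 7 + k * (n - 1) = p" using p by simp
    then have "card F \<in> sizes" using F unfolding sizes by blast
    moreover have "2 * card (clique {0..<n - 7}) = (n - 7) * (n - 8)"
      using card_clique[of "{0..<n - 7}"] by simp
    moreover have "M = 0" using False unfolding M_def by simp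
    ultimately show ?thesis using F(3) by force
  qed
  then obtain z where z: "z \<in> sizes" "k * ((n - 1) * (n - 2)) + (n - 7) * (n - 8) + 2 * M \<le> 2 * z"
    by blast
  have "finite sizes"
  proof (rule finite_subset)
    show "sizes \<subseteq> {..k * ((n - 1) * (n - 2)) + (n - 7) * (n - 8) + 2 * M}" using ub by fastforce
  qed simp
  moreover have "y \<le> z" if "y \<in> sizes" for y using ub[OF that] z(2) by linarith
  ultimately have "Max sizes = z" using z(1) by (intro Max_eqI)
  then have exz: "ex p (T3_vertices n) (T3_edges n) = z" unfolding ex_def sizes_def .
  have "2 * z = k * ((n - 1) * (n - 2)) + (n - 7) * (n - 8) + 2 * M"
    using z(2) ub[OF z(1)] by linarith
  then have "real (2 * z) = real (k * ((n - 1) * (n - 2)) + (n - 7) * (n - 8) + 2 * M)"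
    by (rule arg_cong)
  moreover have "real (n - 1) = real n - 1" "real (n - 2) = real n - 2"
    "real (n - 7) = real n - 7" "real (n - 8) = real n - 8"
    using assms(1) by simp_all
  ultimately have double: "2 * real (ex p (T3_vertices n) (T3_edges n)) =
    real k * ((real n - 1) * (real n - 2)) + (real n - 7) * (real n - 8) + 2 * real M"
    by (simp only: exz of_nat_mult of_nat_add of_nat_numeral)
  have real_p: "real p = real k * (real n - 1) + (real n - 7)"
    using p assms(1) by (simp add: of_nat_diff)
  have real_n2: "real (n - 2) = real n - 2" using assms(1) by (simp add: of_nat_diff)
  \<comment> \<open>The truncated subtraction in \<open>M\<close> stands for the maximum with
    0.\<close>
  have max_M: "max \<lfloor>(real n - 37) / 4\<rfloor> 0 = int M"
  proof (cases "37 \<le> n")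
    case True
    then have "(real n - 37) / 4 = real (n - 37) / real 4" by (simp add: of_nat_diff)
    then show ?thesis unfolding M_def by (simp only: floor_divide_of_nat_eq)
  next
    case False
    then show ?thesis unfolding M_def by (simp add: max_def)
  qed
  \<comment> \<open>Behind this is
    \<open>(n - 2) * (n - 7) - 6 * (n - 7) = (n - 7) * (n - 8)\<close>.\<close>
  show ?thesis unfolding real_p real_n2 max_M using double by (simp add: field_simps)
qed

end
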